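(* Let $d \ge 2$ and identify $\mathbb{R}^{d-1}$ with $\mathbb{R}^{d-1}\times\{0\} \subset \mathbb{R}^d$, writing points of $\mathbb{R}^d$ as $(z,t)$ with $z \in \mathbb{R}^{d-1}$, $t \in \mathbb{R}$. For every $\varepsilon > 0$ and $0 < \delta < 1$ there exists $0 < \kappa < 1$ with the following property: for any ball $\mathcal{C} \subset \mathbb{R}^{d-1}$ there exists $\tau^* > 0$ such that for every $0 < \tau < \tau^*$ there exists a diffeomorphism $H : \mathbb{R}^d \to \mathbb{R}^d$ such that (i) $H$ has derivative $\varepsilon$-close to the identity (i.e. $\|DH(x) - \mathrm{id}\| \le \varepsilon$ for all $x$); (ii) $H$ equals the identity outside $\mathcal{C}\times[-\tau,\tau]$; (iii) if $(z,t) \in (1-\delta)(\mathcal{C}\times[-\tau,\tau])$ then $H(z,t) = (z,\kappa t)$.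
   Context: A subset $B$ of a finite-dimensional real vector space $V$ is called a ball if there exists a norm on $V$ such that $B$ is the closed unit ball of $V$ with respect to that norm. *)

theory Defs
  imports "HOL-Analysis.Analysis"
begin

text \<open>A norm on a real vector space (an arbitrary one, not necessarily the ambient norm).\<close>
definition is_norm :: "('a::real_vector \<Rightarrow> real) \<Rightarrow> bool" where
  "is_norm N \<longleftrightarrow>
     (\<forall>x. 0 \<le> N x) \<and> (\<forall>x. N x = 0 \<longleftrightarrow> x = 0) \<and>
     (\<forall>c x. N (c *\<^sub>R x) = \<bar>c\<bar> * N x) \<and> (\<forall>x y. N (x + y) \<le> N x + N y)"

text \<open>A ball: the closed unit ball of some norm.\<close>
definition is_ball :: "'a::real_vector set \<Rightarrow> bool" where
  "is_ball B \<longleftrightarrow> (\<exists>N. is_norm N \<and> B = {x. N x \<le> 1})"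

text \<open>A (C^1) diffeomorphism of a Euclidean space onto itself.\<close>
definition C1_diffeo :: "('a::euclidean_space \<Rightarrow> 'a) \<Rightarrow> bool" where
  "C1_diffeo H \<longleftrightarrow> bij H \<and>
     (\<exists>D. (\<forall>x. (H has_derivative blinfun_apply (D x)) (at x)) \<and> continuous_on UNIV D) \<and>
     (\<exists>D. (\<forall>x. (inv H has_derivative blinfun_apply (D x)) (at x)) \<and> continuous_on UNIV D)"

end

theory Submission
  imports Defs
begin

(*
  H is a vertical shear H(z, t) = (z, t - s phi(z) rho(t)), so that kappa = 1 - s.  The bump phi is
  C^1, equals 1 on (1 - delta) C and vanishes off C; it is built from finitely many radial cutoffs,
  since the unit ball of any norm is compact.  The profile rho(t) = t gamma(t), with gamma a cutoff
  equal to 1 on [-(1 - delta) tau, (1 - delta) tau] and 0 outside (-tau, tau), satisfies |rho| <= tau,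
  and because gamma is rescaled with tau, |rho'| <= 1 + 4 / (1 - (1 - delta)^2) independently of tau.
  So the perturbation has derivative at most s (L tau + 1 + 4 / (1 - (1 - delta)^2)), L bounding
  D phi: s is chosen from epsilon and delta alone, and then tau small in terms of C.
  Finally, a vertical shear whose perturbation has derivative bounded by c < 1 is a C^1
  diffeomorphism: it is onto by the Banach fixed point theorem, its inverse is Lipschitz, and the
  derivative of the inverse is the explicit inverse of a linear shear.
*)

section \<open>A C^1 step function and radial cutoffs\<close>

definition pos_sq :: "real \<Rightarrow> real" where
  "pos_sq x = (max 0 x)\<^sup>2"

lemma pos_sq_has_real_derivative: "(pos_sq has_real_derivative 2 * max 0 x) (at x)"
proof (cases x "0::real" rule: linorder_cases)
  case less
  have "(pos_sq has_real_derivative 0) (at x)"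
    by (rule has_field_derivative_transform_within_open[where f="\<lambda>_. 0" and S="{..<0}"])
       (use less in \<open>auto simp: pos_sq_def\<close>)
  with less show ?thesis by simp
next
  case greater
  have "(pos_sq has_real_derivative 2 * x) (at x)"
    by (rule has_field_derivative_transform_within_open[where f="\<lambda>y. y\<^sup>2" and S="{0<..}"])
       (use greater in \<open>auto intro!: derivative_eq_intros simp: pos_sq_def\<close>)
  with greater show ?thesis by simp
next
  case equal
  have "((\<lambda>y. (pos_sq y - pos_sq 0) / (y - 0)) \<longlongrightarrow> 0) (at 0)"
  proof (rule Lim_null_comparison[where g="\<lambda>y. \<bar>y\<bar>"])
    show "\<forall>\<^sub>F y in at 0. norm ((pos_sq y - pos_sq 0) / (y - 0)) \<le> \<bar>y\<bar>"
      by (auto simp: pos_sq_def power2_eq_square abs_mult max_def divide_simps)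
    show "((\<lambda>y::real. \<bar>y\<bar>) \<longlongrightarrow> 0) (at 0)"
      using tendsto_rabs[OF tendsto_ident_at[of "0::real" UNIV]] by simp
  qed
  then show ?thesis using equal by (simp add: has_field_derivative_iff)
qed

definition smoothstep :: "real \<Rightarrow> real" where
  "smoothstep u = 2 * pos_sq u - 4 * pos_sq (u - 1/2) + 2 * pos_sq (u - 1)"

definition smoothstep' :: "real \<Rightarrow> real" where
  "smoothstep' u = 4 * max 0 u - 8 * max 0 (u - 1/2) + 4 * max 0 (u - 1)"

lemma smoothstep_has_real_derivative: "(smoothstep has_real_derivative smoothstep' u) (at u)"
  unfolding smoothstep_def[abs_def] smoothstep'_def
  by (auto intro!: derivative_eq_intros DERIV_chain2[OF pos_sq_has_real_derivative])

lemma continuous_on_smoothstep': "continuous_on S smoothstep'"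
  unfolding smoothstep'_def[abs_def] by (intro continuous_intros)

lemma smoothstep_eq_0: "u \<le> 0 \<Longrightarrow> smoothstep u = 0"
  by (simp add: smoothstep_def pos_sq_def)

lemma smoothstep_eq_1: "1 \<le> u \<Longrightarrow> smoothstep u = 1"
  by (simp add: smoothstep_def pos_sq_def max_def power2_eq_square algebra_simps)

lemma smoothstep_bounds: "0 \<le> smoothstep u \<and> smoothstep u \<le> 1"
proof -
  consider "u \<le> 0" | "0 \<le> u" "u \<le> 1/2" | "1/2 \<le> u" "u \<le> 1" | "1 \<le> u" by linarith
  then show ?thesis
  proof cases
    case 2
    then have "smoothstep u = 2 * u\<^sup>2"
      by (simp add: smoothstep_def pos_sq_def max_def)
    moreover have "u\<^sup>2 \<le> (1/2)\<^sup>2" using 2 by (intro power_mono) auto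
    ultimately show ?thesis by (simp add: power2_eq_square)
  next
    case 3
    then have "smoothstep u = 1 - 2 * (1 - u)\<^sup>2"
      by (simp add: smoothstep_def pos_sq_def max_def power2_eq_square algebra_simps)
    moreover have "(1 - u)\<^sup>2 \<le> (1/2)\<^sup>2" using 3 by (intro power_mono) auto
    ultimately show ?thesis by (simp add: power2_eq_square)
  qed (simp_all add: smoothstep_eq_0 smoothstep_eq_1)
qed

lemma smoothstep'_bounds: "0 \<le> smoothstep' u \<and> smoothstep' u \<le> 2"
  unfolding smoothstep'_def max_def by auto

lemma smoothstep'_eq_0: "1 \<le> u \<Longrightarrow> smoothstep' u = 0"
  unfolding smoothstep'_def max_def by auto

definition cutoff :: "'a::real_inner \<Rightarrow> real \<Rightarrow> real \<Rightarrow> 'a \<Rightarrow> real" where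
  "cutoff c a b z = 1 - smoothstep (((norm (z - c))\<^sup>2 - a\<^sup>2) / (b\<^sup>2 - a\<^sup>2))"

definition cutoff_deriv :: "'a::real_inner \<Rightarrow> real \<Rightarrow> real \<Rightarrow> 'a \<Rightarrow> 'a \<Rightarrow> real" where
  "cutoff_deriv c a b z v =
     - smoothstep' (((norm (z - c))\<^sup>2 - a\<^sup>2) / (b\<^sup>2 - a\<^sup>2)) * (2 * ((z - c) \<bullet> v) / (b\<^sup>2 - a\<^sup>2))"

lemma cutoff_has_derivative: "(cutoff c a b has_derivative cutoff_deriv c a b z) (at z)"
proof -
  have "((\<lambda>z. ((norm (z - c))\<^sup>2 - a\<^sup>2) / (b\<^sup>2 - a\<^sup>2)) has_derivative
          (\<lambda>v. 2 * ((z - c) \<bullet> v) / (b\<^sup>2 - a\<^sup>2))) (at z)"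
    unfolding power2_norm_eq_inner divide_inverse
    by (auto intro!: derivative_eq_intros simp: inner_commute)
  from has_derivative_compose[OF this smoothstep_has_real_derivative[unfolded has_field_derivative_def]]
  show ?thesis
    unfolding cutoff_def[abs_def] cutoff_deriv_def
    by (auto intro!: derivative_eq_intros)
qed

lemma continuous_on_cutoff_deriv: "continuous_on S (\<lambda>z. cutoff_deriv c a b z v)"
  unfolding cutoff_deriv_def divide_inverse
  by (intro continuous_intros continuous_on_compose2[OF continuous_on_smoothstep' _ subset_UNIV])

lemma cutoff_bounds: "0 \<le> cutoff c a b z \<and> cutoff c a b z \<le> 1"
  using smoothstep_bounds by (simp add: cutoff_def)

lemma cutoff_eq_1:
  assumes "0 \<le> a" "a < b" "norm (z - c) \<le> a"
  shows "cutoff c a b z = 1"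
proof -
  have "(norm (z - c))\<^sup>2 \<le> a\<^sup>2" "a\<^sup>2 < b\<^sup>2"
    using assms by (auto intro: power_mono power_strict_mono)
  then show ?thesis by (simp add: cutoff_def smoothstep_eq_0 divide_nonpos_pos)
qed

lemma cutoff_eq_0:
  assumes "0 \<le> a" "a < b" "b \<le> norm (z - c)"
  shows "cutoff c a b z = 0"
proof -
  have "b\<^sup>2 \<le> (norm (z - c))\<^sup>2" "a\<^sup>2 < b\<^sup>2"
    using assms by (auto intro: power_mono power_strict_mono)
  then show ?thesis by (simp add: cutoff_def smoothstep_eq_1)
qed

lemma cutoff_deriv_eq_0:
  assumes "0 \<le> a" "a < b" "b \<le> norm (z - c)"
  shows "cutoff_deriv c a b z v = 0"
proof -
  have "b\<^sup>2 \<le> (norm (z - c))\<^sup>2" "a\<^sup>2 < b\<^sup>2"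
    using assms by (auto intro: power_mono power_strict_mono)
  then show ?thesis by (simp add: cutoff_deriv_def smoothstep'_eq_0)
qed

lemma abs_cutoff_deriv_le:
  assumes "a\<^sup>2 < b\<^sup>2"
  shows "\<bar>cutoff_deriv c a b z v\<bar> \<le> 4 * norm (z - c) * norm v / (b\<^sup>2 - a\<^sup>2)"
proof -
  have "\<bar>cutoff_deriv c a b z v\<bar>
      = smoothstep' (((norm (z - c))\<^sup>2 - a\<^sup>2) / (b\<^sup>2 - a\<^sup>2)) * (2 * \<bar>(z - c) \<bullet> v\<bar> / (b\<^sup>2 - a\<^sup>2))"
    using smoothstep'_bounds assms by (simp add: cutoff_deriv_def abs_mult)
  also have "\<dots> \<le> 2 * (2 * (norm (z - c) * norm v) / (b\<^sup>2 - a\<^sup>2))"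
    using smoothstep'_bounds assms Cauchy_Schwarz_ineq2
    by (intro mult_mono divide_right_mono) auto
  finally show ?thesis by simp
qed

lemma abs_cutoff_deriv_le_uniform:
  assumes "0 \<le> a" "a < b"
  shows "\<bar>cutoff_deriv c a b z v\<bar> \<le> 4 * b / (b\<^sup>2 - a\<^sup>2) * norm v"
proof (cases "b \<le> norm (z - c)")
  case True
  with assms show ?thesis by (simp add: cutoff_deriv_eq_0 power_strict_mono)
next
  case False
  have "a\<^sup>2 < b\<^sup>2" using assms by (simp add: power_strict_mono)
  then have "\<bar>cutoff_deriv c a b z v\<bar> \<le> 4 * norm (z - c) * norm v / (b\<^sup>2 - a\<^sup>2)"
    by (rule abs_cutoff_deriv_le)
  also have "\<dots> \<le> 4 * b * norm v / (b\<^sup>2 - a\<^sup>2)"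
    using False \<open>a\<^sup>2 < b\<^sup>2\<close> by (intro divide_right_mono mult_right_mono) auto
  finally show ?thesis by simp
qed

lemma norm_mult_abs_cutoff_deriv_le:
  assumes "0 \<le> a" "a < b"
  shows "norm (z - c) * \<bar>cutoff_deriv c a b z v\<bar> \<le> 4 * b\<^sup>2 / (b\<^sup>2 - a\<^sup>2) * norm v"
proof (cases "b \<le> norm (z - c)")
  case True
  with assms show ?thesis by (simp add: cutoff_deriv_eq_0 power_strict_mono)
next
  case False
  have "a\<^sup>2 < b\<^sup>2" using assms by (simp add: power_strict_mono)
  then have "norm (z - c) * \<bar>cutoff_deriv c a b z v\<bar>
      \<le> norm (z - c) * (4 * norm (z - c) * norm v / (b\<^sup>2 - a\<^sup>2))"
    by (intro mult_left_mono abs_cutoff_deriv_le) auto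
  also have "\<dots> = 4 * (norm (z - c))\<^sup>2 * norm v / (b\<^sup>2 - a\<^sup>2)" by (simp add: power2_eq_square)
  also have "\<dots> \<le> 4 * b\<^sup>2 * norm v / (b\<^sup>2 - a\<^sup>2)"
    using False \<open>a\<^sup>2 < b\<^sup>2\<close> by (intro divide_right_mono mult_right_mono) (auto intro: power_mono)
  finally show ?thesis by simp
qed

lemma abs_sum_cutoff_deriv_le:
  assumes "0 \<le> a" "a < b"
  shows "\<bar>\<Sum>c\<in>F. cutoff_deriv c a b z v\<bar> \<le> card F * (4 * b / (b\<^sup>2 - a\<^sup>2)) * norm v"
proof -
  have "\<bar>\<Sum>c\<in>F. cutoff_deriv c a b z v\<bar> \<le> (\<Sum>c\<in>F. \<bar>cutoff_deriv c a b z v\<bar>)" by (rule sum_abs)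
  also have "\<dots> \<le> (\<Sum>c\<in>F. 4 * b / (b\<^sup>2 - a\<^sup>2) * norm v)"
    by (intro sum_mono abs_cutoff_deriv_le_uniform assms)
  finally show ?thesis by simp
qed

section \<open>Bump functions\<close>

lemma compact_finite_ball_cover_in_open:
  fixes K U :: "'a::metric_space set"
  assumes "compact K" "open U" "K \<subseteq> U"
  obtains F r where "finite F" "0 < r" "K \<subseteq> (\<Union>c\<in>F. ball c r)" "\<And>c. c \<in> F \<Longrightarrow> ball c (2 * r) \<subseteq> U"
proof -
  obtain e where e: "0 < e" "\<And>x. x \<in> K \<Longrightarrow> ball x e \<subseteq> U"
    using Heine_Borel_lemma[OF \<open>compact K\<close>, of "{U}"] assms by auto
  have "K \<subseteq> (\<Union>c\<in>K. ball c (e / 2))" using \<open>0 < e\<close> by auto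
  then obtain F where "F \<subseteq> K" "finite F" "K \<subseteq> (\<Union>c\<in>F. ball c (e / 2))"
    using compactE_image[OF \<open>compact K\<close>, of K "\<lambda>c. ball c (e / 2)"] by blast
  with e show ?thesis by (intro that[of F "e / 2"]) auto
qed

lemma C1_bump_exists:
  fixes K U :: "'a::real_inner set"
  assumes "compact K" "open U" "K \<subseteq> U"
  obtains \<phi> \<phi>' L where "\<And>z. (\<phi> has_derivative \<phi>' z) (at z)"
    "\<And>v. continuous_on UNIV (\<lambda>z. \<phi>' z v)" "0 \<le> L" "\<And>z v. \<bar>\<phi>' z v\<bar> \<le> L * norm v"
    "\<And>z. 0 \<le> \<phi> z \<and> \<phi> z \<le> 1" "\<And>z. z \<in> K \<Longrightarrow> \<phi> z = 1" "\<And>z. z \<notin> U \<Longrightarrow> \<phi> z = 0"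
proof -
  obtain F r where F: "finite F" "0 < r" "K \<subseteq> (\<Union>c\<in>F. ball c r)"
    and margin: "\<And>c. c \<in> F \<Longrightarrow> ball c (2 * r) \<subseteq> U"
    using compact_finite_ball_cover_in_open[OF assms] by blast
  define S where "S z = (\<Sum>c\<in>F. cutoff c r (2 * r) z)" for z
  define S' where "S' z v = (\<Sum>c\<in>F. cutoff_deriv c r (2 * r) z v)" for z v
  define B where "B = card F * (4 * (2 * r) / ((2 * r)\<^sup>2 - r\<^sup>2))"
  have dS: "(S has_derivative S' z) (at z)" for z
    unfolding S_def[abs_def] S'_def by (intro has_derivative_sum cutoff_has_derivative)
  have "0 \<le> B" using \<open>0 < r\<close> by (simp add: B_def power2_eq_square)
  have S': "\<bar>S' z v\<bar> \<le> B * norm v" for z v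
    unfolding S'_def B_def using \<open>0 < r\<close> by (intro abs_sum_cutoff_deriv_le) auto
  show ?thesis
  proof (rule that[of "\<lambda>z. smoothstep (S z)" "\<lambda>z v. smoothstep' (S z) * S' z v" "2 * B"])
    show "((\<lambda>z. smoothstep (S z)) has_derivative (\<lambda>v. smoothstep' (S z) * S' z v)) (at z)" for z
      using has_derivative_compose[OF dS smoothstep_has_real_derivative[unfolded has_field_derivative_def]]
      by (simp add: mult.commute)
    have "continuous_on UNIV S" using dS by (intro has_derivative_continuous_on) auto
    then show "continuous_on UNIV (\<lambda>z. smoothstep' (S z) * S' z v)" for v
      unfolding S'_def
      by (intro continuous_intros continuous_on_compose2[OF continuous_on_smoothstep']
          continuous_on_cutoff_deriv) auto
    show "0 \<le> 2 * B" using \<open>0 \<le> B\<close> by simp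
    show "\<bar>smoothstep' (S z) * S' z v\<bar> \<le> 2 * B * norm v" for z v
      using smoothstep'_bounds[of "S z"] S'[of z v] unfolding abs_mult mult.assoc
      by (intro mult_mono) auto
    show "0 \<le> smoothstep (S z) \<and> smoothstep (S z) \<le> 1" for z by (rule smoothstep_bounds)
    show "smoothstep (S z) = 1" if "z \<in> K" for z
    proof -
      obtain c where c: "c \<in> F" "norm (z - c) < r"
        using F(3) \<open>z \<in> K\<close> by (force simp: dist_norm norm_minus_commute)
      then have "cutoff c r (2 * r) z = 1" using \<open>0 < r\<close> by (intro cutoff_eq_1) auto
      moreover have "cutoff c r (2 * r) z \<le> S z"
        unfolding S_def by (rule member_le_sum[OF c(1)]) (use cutoff_bounds F(1) in auto)
      ultimately show ?thesis by (simp add: smoothstep_eq_1)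
    qed
    show "smoothstep (S z) = 0" if "z \<notin> U" for z
    proof -
      have "cutoff c r (2 * r) z = 0" if "c \<in> F" for c
        using margin[OF that] \<open>z \<notin> U\<close> \<open>0 < r\<close>
        by (intro cutoff_eq_0) (auto simp: dist_norm norm_minus_commute not_less)
      then show ?thesis by (simp add: S_def smoothstep_eq_0)
    qed
  qed
qed

lemma is_norm_convex_on:
  assumes "is_norm N"
  shows "convex_on UNIV N"
proof
  fix t :: real and x y :: 'a assume "0 < t" "t < 1"
  then show "N ((1 - t) *\<^sub>R x + t *\<^sub>R y) \<le> (1 - t) * N x + t * N y"
    using assms unfolding is_norm_def by (metis abs_of_pos diff_gt_0_iff_gt)
qed simp

lemma is_norm_continuous_on:
  fixes N :: "'a::euclidean_space \<Rightarrow> real"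
  assumes "is_norm N"
  shows "continuous_on UNIV N"
  using convex_on_continuous[OF open_UNIV is_norm_convex_on[OF assms]] .

lemma is_norm_lower_bound:
  fixes N :: "'a::euclidean_space \<Rightarrow> real"
  assumes N: "is_norm N"
  obtains m where "0 < m" "\<And>w. m * norm w \<le> N w"
proof -
  let ?S = "sphere (0::'a) 1"
  have "\<exists>y\<in>?S. \<forall>x\<in>?S. N y \<le> N x"
    by (intro continuous_attains_inf continuous_on_subset[OF is_norm_continuous_on[OF N]])
       (auto simp: sphere_eq_empty)
  then obtain y where y: "y \<in> ?S" "\<And>x. x \<in> ?S \<Longrightarrow> N y \<le> N x" by blast
  have "N y > 0" using y(1) N by (auto simp: is_norm_def less_le)
  moreover have "N y * norm w \<le> N w" for w
  proof (cases "w = 0")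
    case False
    have "N y \<le> N ((1 / norm w) *\<^sub>R w)" using y(2)[of "(1 / norm w) *\<^sub>R w"] False by simp
    also have "\<dots> = N w / norm w" using N by (simp add: is_norm_def)
    finally show ?thesis using False by (simp add: field_simps)
  qed (use N in \<open>simp add: is_norm_def\<close>)
  ultimately show ?thesis by (rule that)
qed

lemma is_norm_sublevel_compact:
  fixes N :: "'a::euclidean_space \<Rightarrow> real"
  assumes N: "is_norm N"
  shows "compact {z. N z \<le> a}"
proof -
  obtain m where m: "0 < m" "\<And>w. m * norm w \<le> N w" using is_norm_lower_bound[OF N] by blast
  have "closed {z. N z \<le> a}"
    using closed_Collect_le[OF is_norm_continuous_on[OF N] continuous_on_const] by simp
  moreover have "{z. N z \<le> a} \<subseteq> cball 0 (a / m)"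
  proof
    fix z assume "z \<in> {z. N z \<le> a}"
    then have "m * norm z \<le> a" using m(2)[of z] by simp
    then show "z \<in> cball 0 (a / m)" using m(1) by (simp add: field_simps)
  qed
  ultimately show ?thesis by (meson bounded_cball bounded_subset compact_eq_bounded_closed)
qed

lemma is_ball_C1_bump_exists:
  fixes C :: "'a::euclidean_space set"
  assumes "is_ball C" "0 < \<delta>" "\<delta> \<le> 1"
  obtains \<phi> \<phi>' L where "\<And>z. (\<phi> has_derivative \<phi>' z) (at z)"
    "\<And>v. continuous_on UNIV (\<lambda>z. \<phi>' z v)" "0 \<le> L" "\<And>z v. \<bar>\<phi>' z v\<bar> \<le> L * norm v"
    "\<And>z. 0 \<le> \<phi> z \<and> \<phi> z \<le> 1" "\<And>z. z \<in> (*\<^sub>R) (1 - \<delta>) ` C \<Longrightarrow> \<phi> z = 1"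
    "\<And>z. z \<notin> C \<Longrightarrow> \<phi> z = 0"
proof -
  obtain N where N: "is_norm N" and C: "C = {z. N z \<le> 1}"
    using \<open>is_ball C\<close> by (auto simp: is_ball_def)
  have "open {z. N z < 1}"
    using open_Collect_less[OF is_norm_continuous_on[OF N] continuous_on_const] by simp
  moreover have "{z. N z \<le> 1 - \<delta>} \<subseteq> {z. N z < 1}" using \<open>0 < \<delta>\<close> by auto
  ultimately obtain \<phi> \<phi>' L where \<phi>: "\<And>z. (\<phi> has_derivative \<phi>' z) (at z)"
    "\<And>v. continuous_on UNIV (\<lambda>z. \<phi>' z v)" "0 \<le> L" "\<And>z v. \<bar>\<phi>' z v\<bar> \<le> L * norm v"
    "\<And>z. 0 \<le> \<phi> z \<and> \<phi> z \<le> 1" and inner: "\<And>z. z \<in> {z. N z \<le> 1 - \<delta>} \<Longrightarrow> \<phi> z = 1"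
    and outer: "\<And>z. z \<notin> {z. N z < 1} \<Longrightarrow> \<phi> z = 0"
    by (rule C1_bump_exists[OF is_norm_sublevel_compact[OF N]]) blast
  show ?thesis
  proof (rule that[OF \<phi>])
    fix z
    show "\<phi> z = 1" if z: "z \<in> (*\<^sub>R) (1 - \<delta>) ` C"
    proof (rule inner)
      obtain y where "y \<in> C" "z = (1 - \<delta>) *\<^sub>R y" using z by blast
      then have "N z = (1 - \<delta>) * N y"
        using N \<open>\<delta> \<le> 1\<close> unfolding is_norm_def by simp
      also have "\<dots> \<le> 1 - \<delta>"
        using \<open>y \<in> C\<close> \<open>\<delta> \<le> 1\<close> by (simp add: C mult_left_le)
      finally show "z \<in> {z. N z \<le> 1 - \<delta>}" by simp
    qed
    show "\<phi> z = 0" if "z \<notin> C"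
      using that by (intro outer) (simp add: C)
  qed
qed

section \<open>Vertical shears\<close>

lemma componentwise_continuous_derivative_blinfun:
  fixes f :: "'a::euclidean_space \<Rightarrow> 'b::real_normed_vector"
  assumes "\<And>x. (f has_derivative D x) (at x)" "\<And>v. continuous_on UNIV (\<lambda>x. D x v)"
  shows "\<exists>D'. (\<forall>x. (f has_derivative blinfun_apply (D' x)) (at x)) \<and> continuous_on UNIV D'"
proof (intro exI conjI allI)
  have lin: "bounded_linear (D x)" for x using assms(1) by (rule has_derivative_bounded_linear)
  show "(f has_derivative blinfun_apply (Blinfun (D x))) (at x)" for x
    using assms(1) by (simp add: bounded_linear_Blinfun_apply lin)
  show "continuous_on UNIV (\<lambda>x. Blinfun (D x))"
    using assms(2) by (intro continuous_on_blinfun_componentwise) (simp add: bounded_linear_Blinfun_apply lin)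
qed

lemma C1_diffeoI:
  fixes H :: "'a::euclidean_space \<Rightarrow> 'a"
  assumes "bij H"
    and "\<And>x. (H has_derivative D x) (at x)" "\<And>v. continuous_on UNIV (\<lambda>x. D x v)"
    and "\<And>y. (inv H has_derivative E y) (at y)" "\<And>v. continuous_on UNIV (\<lambda>y. E y v)"
  shows "C1_diffeo H"
  using assms componentwise_continuous_derivative_blinfun unfolding C1_diffeo_def by blast

definition vertical_shear :: "('a \<times> real \<Rightarrow> real) \<Rightarrow> 'a \<times> real \<Rightarrow> 'a \<times> real" where
  "vertical_shear u p = (fst p, snd p + u p)"

lemma has_derivative_vertical_shear:
  fixes u :: "'a::real_normed_vector \<times> real \<Rightarrow> real"
  assumes "(u has_derivative u') (at x)"
  shows "(vertical_shear u has_derivative vertical_shear u') (at x)"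
  unfolding vertical_shear_def[abs_def] by (auto intro!: derivative_eq_intros assms)

lemma onorm_vertical_shear_minus_id_le:
  fixes l :: "'a::euclidean_space \<times> real \<Rightarrow> real"
  assumes "\<And>v. \<bar>l v\<bar> \<le> c * norm v"
  shows "onorm (\<lambda>v. vertical_shear l v - v) \<le> c"
proof (rule onorm_le)
  fix v
  have "vertical_shear l v - v = (0, l v)" by (simp add: vertical_shear_def prod_eq_iff)
  then show "norm (vertical_shear l v - v) \<le> c * norm v" using assms by (simp add: norm_Pair)
qed

lemma dist_vertical_shear_ge:
  fixes u :: "'a::real_normed_vector \<times> real \<Rightarrow> real"
  assumes "c-lipschitz_on UNIV u"
  shows "(1 - c) * dist x y \<le> dist (vertical_shear u x) (vertical_shear u y)"
proof -
  have "vertical_shear u x - vertical_shear u y = (x - y) + (0, u x - u y)"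
    by (simp add: vertical_shear_def prod_eq_iff)
  then have "dist x y \<le> dist (vertical_shear u x) (vertical_shear u y) + \<bar>u x - u y\<bar>"
    using norm_triangle_ineq4[of "vertical_shear u x - vertical_shear u y" "(0, u x - u y)"]
    by (simp add: dist_norm norm_Pair)
  moreover have "\<bar>u x - u y\<bar> \<le> c * dist x y"
    using lipschitz_onD[OF assms] by (simp add: dist_real_def)
  ultimately show ?thesis by (simp add: algebra_simps)
qed

lemma bij_vertical_shear:
  fixes u :: "'a::banach \<times> real \<Rightarrow> real"
  assumes "c-lipschitz_on UNIV u" "c < 1"
  shows "bij (vertical_shear u)"
proof (rule bijI)
  show "inj (vertical_shear u)"
  proof (rule injI)
    fix x y assume "vertical_shear u x = vertical_shear u y"
    then show "x = y"
      using dist_vertical_shear_ge[OF assms(1), of x y] \<open>c < 1\<close> by (simp add: mult_le_0_iff)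
  qed
  have "\<exists>x. vertical_shear u x = y" for y :: "'a \<times> real"
  proof -
    have "(y - (0, u a)) - (y - (0, u b)) = (0, u b - u a)" for a b by (simp add: prod_eq_iff)
    then have "dist (y - (0, u a)) (y - (0, u b)) = dist (u a) (u b)" for a b
      by (simp add: dist_norm norm_Pair dist_real_def abs_minus_commute)
    then have "\<forall>a b. dist (y - (0, u a)) (y - (0, u b)) \<le> c * dist a b"
      using lipschitz_onD[OF assms(1)] by simp
    from banach_fix_type[OF lipschitz_on_nonneg[OF assms(1)] \<open>c < 1\<close> this]
    obtain x where "y - (0, u x) = x" by blast
    then have "vertical_shear u x = y" by (auto simp: vertical_shear_def prod_eq_iff)
    then show ?thesis ..
  qed
  then show "surj (vertical_shear u)" by (metis surjI)
qed

lemma lipschitz_on_inv_vertical_shear: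
  fixes u :: "'a::banach \<times> real \<Rightarrow> real"
  assumes "c-lipschitz_on UNIV u" "c < 1"
  shows "(1 / (1 - c))-lipschitz_on UNIV (inv (vertical_shear u))"
proof (rule lipschitz_onI)
  have "surj (vertical_shear u)" using bij_vertical_shear[OF assms] by (rule bij_is_surj)
  then show "dist (inv (vertical_shear u) x) (inv (vertical_shear u) y) \<le> 1 / (1 - c) * dist x y" for x y
    using dist_vertical_shear_ge[OF assms(1), of "inv (vertical_shear u) x" "inv (vertical_shear u) y"]
      \<open>c < 1\<close> by (simp add: surj_f_inv_f field_simps)
qed (use \<open>c < 1\<close> in simp)

definition linear_vertical_shear_inverse :: "('a::real_vector \<times> real \<Rightarrow> real) \<Rightarrow> 'a \<times> real \<Rightarrow> 'a \<times> real"
  where "linear_vertical_shear_inverse l v = (fst v, (snd v - l (fst v, 0)) / (1 + l (0, 1)))"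

lemma linear_vertical_shear_inverse_comp:
  fixes l :: "'a::real_vector \<times> real \<Rightarrow> real"
  assumes "linear l" "1 + l (0, 1) \<noteq> 0"
  shows "linear_vertical_shear_inverse l \<circ> vertical_shear l = id"
proof
  fix v :: "'a \<times> real"
  obtain a b where v: "v = (a, b)" by (cases v)
  have "l (a, b) = l (a, 0) + b * l (0, 1)"
    using linear_add[OF assms(1), of "(a, 0)" "(0, b)"] linear_scale[OF assms(1), of b "(0, 1)"] by simp
  then have "b + l (a, b) - l (a, 0) = b * (1 + l (0, 1))" by (simp add: algebra_simps)
  then show "(linear_vertical_shear_inverse l \<circ> vertical_shear l) v = id v"
    using assms(2) by (simp add: v vertical_shear_def linear_vertical_shear_inverse_def)
qed

lemma bounded_linear_linear_vertical_shear_inverse: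
  assumes "bounded_linear l"
  shows "bounded_linear (linear_vertical_shear_inverse l)"
  unfolding linear_vertical_shear_inverse_def
  by (intro bounded_linear_intros bounded_linear_compose[OF bounded_linear_divide]
      bounded_linear_compose[OF assms])

lemma continuous_on_linear_vertical_shear_inverse:
  assumes "\<And>w. continuous_on S (\<lambda>y. l y w)" "\<And>y. y \<in> S \<Longrightarrow> 1 + l y (0, 1) \<noteq> 0"
  shows "continuous_on S (\<lambda>y. linear_vertical_shear_inverse (l y) v)"
  unfolding linear_vertical_shear_inverse_def using assms by (intro continuous_intros) auto

lemma pointwise_bounded_derivative_imp_lipschitz:
  fixes u :: "'a::euclidean_space \<Rightarrow> real"
  assumes "\<And>x. (u has_derivative u' x) (at x)" "\<And>x v. \<bar>u' x v\<bar> \<le> c * norm v" "0 \<le> c"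
  shows "c-lipschitz_on UNIV u"
  using assms by (intro bounded_derivative_imp_lipschitz onorm_le) auto

lemma has_derivative_inv_vertical_shear:
  fixes u :: "'a::euclidean_space \<times> real \<Rightarrow> real"
  assumes der: "\<And>x. (u has_derivative u' x) (at x)"
    and bound: "\<And>x v. \<bar>u' x v\<bar> \<le> c * norm v" and "0 \<le> c" "c < 1"
  defines "g \<equiv> inv (vertical_shear u)"
  shows "(g has_derivative linear_vertical_shear_inverse (u' (g y))) (at y)"
proof -
  have lip: "c-lipschitz_on UNIV u"
    using der bound \<open>0 \<le> c\<close> by (rule pointwise_bounded_derivative_imp_lipschitz)
  have "bij (vertical_shear u)" using lip \<open>c < 1\<close> by (rule bij_vertical_shear)
  then have Hg: "vertical_shear u (g z) = z" for z by (simp add: g_def bij_is_surj surj_f_inv_f)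
  have "continuous_on UNIV g"
    unfolding g_def using lipschitz_on_inv_vertical_shear[OF lip \<open>c < 1\<close>] by (rule lipschitz_on_continuous_on)
  then have "continuous (at y) g" by (simp add: continuous_on_eq_continuous_at del: split_paired_All)
  have lin: "bounded_linear (u' (g y))" using der by (rule has_derivative_bounded_linear)
  have "\<bar>u' (g y) (0, 1)\<bar> \<le> c" using bound[of "g y" "(0, 1)"] by (simp add: norm_Pair)
  then have "1 + u' (g y) (0, 1) \<noteq> 0" using \<open>c < 1\<close> by linarith
  show ?thesis
  proof (rule has_derivative_inverse_basic[where T=UNIV, OF has_derivative_vertical_shear[OF der]])
    show "bounded_linear (linear_vertical_shear_inverse (u' (g y)))"
      using lin by (rule bounded_linear_linear_vertical_shear_inverse)
    show "linear_vertical_shear_inverse (u' (g y)) \<circ> vertical_shear (u' (g y)) = id"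
      using bounded_linear.linear[OF lin] \<open>1 + u' (g y) (0, 1) \<noteq> 0\<close>
      by (rule linear_vertical_shear_inverse_comp)
  qed (use \<open>continuous (at y) g\<close> Hg in auto)
qed

lemma C1_diffeo_vertical_shear:
  fixes u :: "'a::euclidean_space \<times> real \<Rightarrow> real"
  assumes der: "\<And>x. (u has_derivative u' x) (at x)"
    and cont: "\<And>v. continuous_on UNIV (\<lambda>x. u' x v)"
    and bound: "\<And>x v. \<bar>u' x v\<bar> \<le> c * norm v" and "0 \<le> c" "c < 1"
  shows "C1_diffeo (vertical_shear u)"
proof (rule C1_diffeoI)
  let ?g = "inv (vertical_shear u)"
  have lip: "c-lipschitz_on UNIV u"
    using der bound \<open>0 \<le> c\<close> by (rule pointwise_bounded_derivative_imp_lipschitz)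
  then show "bij (vertical_shear u)" using \<open>c < 1\<close> by (rule bij_vertical_shear)
  show "(vertical_shear u has_derivative vertical_shear (u' x)) (at x)" for x
    using der by (rule has_derivative_vertical_shear)
  show "continuous_on UNIV (\<lambda>x. vertical_shear (u' x) v)" for v
    unfolding vertical_shear_def by (intro continuous_intros cont)
  show "(?g has_derivative linear_vertical_shear_inverse (u' (?g y))) (at y)" for y
    using der bound \<open>0 \<le> c\<close> \<open>c < 1\<close> by (rule has_derivative_inv_vertical_shear)
  have "continuous_on UNIV ?g"
    using lipschitz_on_inv_vertical_shear[OF lip \<open>c < 1\<close>] by (rule lipschitz_on_continuous_on)
  moreover have "1 + u' x (0, 1) \<noteq> 0" for x
    using bound[of x "(0, 1)"] \<open>c < 1\<close> by (auto simp: norm_Pair)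
  ultimately show "continuous_on UNIV (\<lambda>y. linear_vertical_shear_inverse (u' (?g y)) v)" for v
    by (intro continuous_on_linear_vertical_shear_inverse continuous_on_compose2[OF cont]) auto
qed

section \<open>Compressing a slab\<close>

lemma compression_profile_exists:
  fixes \<theta> \<tau> :: real
  assumes "0 \<le> \<theta>" "\<theta> < 1" "0 < \<tau>"
  obtains \<rho> \<rho>' where "\<And>t. (\<rho> has_real_derivative \<rho>' t) (at t)" "continuous_on UNIV \<rho>'"
    "\<And>t. \<bar>\<rho> t\<bar> \<le> \<tau>" "\<And>t. \<bar>\<rho>' t\<bar> \<le> 1 + 4 / (1 - \<theta>\<^sup>2)"
    "\<And>t. \<tau> \<le> \<bar>t\<bar> \<Longrightarrow> \<rho> t = 0" "\<And>t. \<bar>t\<bar> \<le> \<theta> * \<tau> \<Longrightarrow> \<rho> t = t"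
proof -
  define \<gamma> where "\<gamma> = cutoff (0::real) (\<theta> * \<tau>) \<tau>"
  define \<gamma>' where "\<gamma>' t = cutoff_deriv (0::real) (\<theta> * \<tau>) \<tau> t 1" for t
  have a: "0 \<le> \<theta> * \<tau>" "\<theta> * \<tau> < \<tau>" using assms by auto
  have d\<gamma>: "(\<gamma> has_real_derivative \<gamma>' t) (at t)" for t
    unfolding \<gamma>_def
    by (rule has_derivative_imp_has_field_derivative[OF cutoff_has_derivative])
       (simp add: \<gamma>'_def cutoff_deriv_def)
  have \<gamma>: "0 \<le> \<gamma> t" "\<gamma> t \<le> 1" for t using cutoff_bounds by (auto simp: \<gamma>_def)
  have outside: "\<gamma> t = 0" if "\<tau> \<le> \<bar>t\<bar>" for t
    using that a by (simp add: \<gamma>_def cutoff_eq_0)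
  have "\<bar>t * \<gamma>' t\<bar> \<le> 4 / (1 - \<theta>\<^sup>2)" for t
  proof -
    have gap: "\<tau>\<^sup>2 - (\<theta> * \<tau>)\<^sup>2 = \<tau>\<^sup>2 * (1 - \<theta>\<^sup>2)" by (simp add: power_mult_distrib algebra_simps)
    have "\<bar>t * \<gamma>' t\<bar> \<le> 4 * \<tau>\<^sup>2 / (\<tau>\<^sup>2 - (\<theta> * \<tau>)\<^sup>2)"
      using norm_mult_abs_cutoff_deriv_le[OF a, of t 0 1] by (simp add: \<gamma>'_def abs_mult)
    also have "\<dots> = 4 / (1 - \<theta>\<^sup>2)" using \<open>0 < \<tau>\<close> by (simp add: gap)
    finally show ?thesis .
  qed
  show ?thesis
  proof (rule that[of "\<lambda>t. t * \<gamma> t" "\<lambda>t. \<gamma> t + t * \<gamma>' t"])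
    show "((\<lambda>t. t * \<gamma> t) has_real_derivative \<gamma> t + t * \<gamma>' t) (at t)" for t
      by (auto intro!: derivative_eq_intros d\<gamma>)
    have "continuous_on UNIV \<gamma>"
      by (intro continuous_at_imp_continuous_on ballI DERIV_isCont[OF d\<gamma>])
    then show "continuous_on UNIV (\<lambda>t. \<gamma> t + t * \<gamma>' t)"
      unfolding \<gamma>'_def by (intro continuous_intros continuous_on_cutoff_deriv)
    show "\<bar>t * \<gamma> t\<bar> \<le> \<tau>" for t
      using outside[of t] \<gamma>[of t] \<open>0 < \<tau>\<close> mult_mono[of "\<bar>t\<bar>" \<tau> "\<gamma> t" 1]
      by (cases "\<tau> \<le> \<bar>t\<bar>") (auto simp: abs_mult)
    show "\<bar>\<gamma> t + t * \<gamma>' t\<bar> \<le> 1 + 4 / (1 - \<theta>\<^sup>2)" for t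
      using \<gamma>[of t] \<open>\<bar>t * \<gamma>' t\<bar> \<le> 4 / (1 - \<theta>\<^sup>2)\<close> by linarith
    show "t * \<gamma> t = 0" if "\<tau> \<le> \<bar>t\<bar>" for t using that by (simp add: outside)
    show "t * \<gamma> t = t" if "\<bar>t\<bar> \<le> \<theta> * \<tau>" for t
      using that a by (simp add: \<gamma>_def cutoff_eq_1)
  qed
qed

lemma has_derivative_mult_fst_snd:
  fixes \<phi> :: "'a::real_normed_vector \<Rightarrow> real"
  assumes "(\<phi> has_derivative \<phi>') (at (fst x))" "(\<psi> has_real_derivative \<psi>') (at (snd x))"
  shows "((\<lambda>p. \<phi> (fst p) * \<psi> (snd p)) has_derivative
          (\<lambda>v. \<phi>' (fst v) * \<psi> (snd x) + \<phi> (fst x) * (\<psi>' * snd v))) (at x)"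
proof -
  have "((\<lambda>p. \<phi> (fst p)) has_derivative (\<lambda>v. \<phi>' (fst v))) (at x)"
    using has_derivative_compose[OF has_derivative_fst[OF has_derivative_ident] assms(1)] by simp
  moreover have "((\<lambda>p. \<psi> (snd p)) has_derivative (\<lambda>v. \<psi>' * snd v)) (at x)"
    using has_derivative_compose[OF has_derivative_snd[OF has_derivative_ident]
        assms(2)[unfolded has_field_derivative_def]] by simp
  ultimately have "((\<lambda>p. \<phi> (fst p) * \<psi> (snd p)) has_derivative
      (\<lambda>v. \<phi> (fst x) * (\<psi>' * snd v) + \<phi>' (fst v) * \<psi> (snd x))) (at x)"
    by (rule has_derivative_mult)
  then show ?thesis by (simp add: algebra_simps)
qed

lemma abs_mult_fst_snd_deriv_le:
  fixes \<phi>' :: "'a::real_normed_vector \<Rightarrow> real"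
  assumes "\<And>w. \<bar>\<phi>' w\<bar> \<le> L * norm w" "0 \<le> L" "\<bar>\<phi>\<bar> \<le> 1" "\<bar>\<psi>\<bar> \<le> B" "\<bar>\<psi>'\<bar> \<le> B'"
  shows "\<bar>\<phi>' (fst v) * \<psi> + \<phi> * (\<psi>' * snd v)\<bar> \<le> (L * B + B') * norm v"
proof -
  have "\<bar>\<phi>' (fst v)\<bar> \<le> L * norm v"
    using assms(1)[of "fst v"] mult_left_mono[OF norm_fst_le[of "fst v" "snd v"] \<open>0 \<le> L\<close>] by simp
  then have "\<bar>\<phi>' (fst v) * \<psi>\<bar> \<le> L * norm v * B"
    using assms(4) \<open>0 \<le> L\<close> unfolding abs_mult by (intro mult_mono) auto
  moreover have "\<bar>\<phi> * (\<psi>' * snd v)\<bar> \<le> 1 * (B' * norm v)"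
    using assms(3,5) norm_snd_le[of "snd v" "fst v"] unfolding abs_mult by (intro mult_mono) auto
  ultimately show ?thesis
    by (rule order_trans[OF abs_triangle_ineq add_mono, THEN order_trans]) (simp add: algebra_simps)
qed

lemma vertical_compression_exists:
  fixes \<phi> :: "'a::euclidean_space \<Rightarrow> real"
  assumes \<phi>: "\<And>z. (\<phi> has_derivative \<phi>' z) (at z)" "\<And>v. continuous_on UNIV (\<lambda>z. \<phi>' z v)"
    "0 \<le> L" "\<And>z v. \<bar>\<phi>' z v\<bar> \<le> L * norm v" "\<And>z. 0 \<le> \<phi> z \<and> \<phi> z \<le> 1"
    and supp: "\<And>z. z \<notin> A \<Longrightarrow> \<phi> z = 0" and plateau: "\<And>z. z \<in> B \<Longrightarrow> \<phi> z = 1"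
    and "0 \<le> \<theta>" "\<theta> < 1" "0 < \<tau>" "0 \<le> s"
  defines "c \<equiv> s * (L * \<tau> + 1 + 4 / (1 - \<theta>\<^sup>2))"
  assumes "c < 1"
  obtains H :: "'a \<times> real \<Rightarrow> 'a \<times> real" where "C1_diffeo H"
    "\<And>x. \<exists>H'. (H has_derivative H') (at x) \<and> onorm (\<lambda>v. H' v - v) \<le> c"
    "\<And>p. p \<notin> A \<times> {-\<tau>..\<tau>} \<Longrightarrow> H p = p"
    "\<And>z t. z \<in> B \<Longrightarrow> \<bar>t\<bar> \<le> \<theta> * \<tau> \<Longrightarrow> H (z, t) = (z, (1 - s) * t)"
proof -
  obtain \<rho> \<rho>' where \<rho>: "\<And>t. (\<rho> has_real_derivative \<rho>' t) (at t)" "continuous_on UNIV \<rho>'"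
    "\<And>t. \<bar>\<rho> t\<bar> \<le> \<tau>" "\<And>t. \<bar>\<rho>' t\<bar> \<le> 1 + 4 / (1 - \<theta>\<^sup>2)"
    and \<rho>_outer: "\<And>t. \<tau> \<le> \<bar>t\<bar> \<Longrightarrow> \<rho> t = 0" and \<rho>_inner: "\<And>t. \<bar>t\<bar> \<le> \<theta> * \<tau> \<Longrightarrow> \<rho> t = t"
    using compression_profile_exists[OF \<open>0 \<le> \<theta>\<close> \<open>\<theta> < 1\<close> \<open>0 < \<tau>\<close>] by blast
  define u where "u p = \<phi> (fst p) * (- s * \<rho> (snd p))" for p
  define u' where "u' x v = \<phi>' (fst x) (fst v) * (- s * \<rho> (snd x)) + \<phi> (fst x) * (- s * \<rho>' (snd x) * snd v)"
    for x v :: "'a \<times> real"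
  have du: "(u has_derivative u' x) (at x)" for x
    unfolding u_def[abs_def] u'_def by (intro has_derivative_mult_fst_snd \<phi>(1) DERIV_cmult \<rho>(1))
  have "continuous_on UNIV \<phi>" using \<phi>(1) by (intro has_derivative_continuous_on) auto
  moreover have "continuous_on UNIV \<rho>" by (intro continuous_at_imp_continuous_on ballI DERIV_isCont[OF \<rho>(1)])
  ultimately have cont: "continuous_on UNIV (\<lambda>x. u' x v)" for v
    unfolding u'_def
    by (intro continuous_intros continuous_on_compose2[OF \<phi>(2)] continuous_on_compose2[OF \<rho>(2)]
        continuous_on_compose2[OF \<open>continuous_on UNIV \<phi>\<close>] continuous_on_compose2[OF \<open>continuous_on UNIV \<rho>\<close>]) auto
  have bound: "\<bar>u' x v\<bar> \<le> c * norm v" for x v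
  proof -
    have "\<bar>- s * \<rho> (snd x)\<bar> \<le> s * \<tau>" "\<bar>- s * \<rho>' (snd x)\<bar> \<le> s * (1 + 4 / (1 - \<theta>\<^sup>2))"
      using \<rho>(3,4)[of "snd x"] \<open>0 \<le> s\<close> by (simp_all add: abs_mult mult_left_mono)
    from abs_mult_fst_snd_deriv_le[OF \<phi>(4)[of "fst x"] \<phi>(3) _ this, of "\<phi> (fst x)" v]
    show ?thesis using \<phi>(5)[of "fst x"] by (simp add: u'_def c_def algebra_simps)
  qed
  have "0 \<le> c" using bound[of undefined "(0, 1)"] by (simp add: norm_Pair)
  show ?thesis
  proof (rule that[of "vertical_shear u"])
    show "C1_diffeo (vertical_shear u)"
      using du cont bound \<open>0 \<le> c\<close> \<open>c < 1\<close> by (rule C1_diffeo_vertical_shear)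
    show "\<exists>H'. (vertical_shear u has_derivative H') (at x) \<and> onorm (\<lambda>v. H' v - v) \<le> c" for x
      using has_derivative_vertical_shear[OF du] onorm_vertical_shear_minus_id_le[OF bound] by (intro exI conjI)
    show "vertical_shear u p = p" if "p \<notin> A \<times> {-\<tau>..\<tau>}" for p
      using that supp \<rho>_outer by (cases p) (auto simp: vertical_shear_def u_def)
    show "vertical_shear u (z, t) = (z, (1 - s) * t)" if "z \<in> B" "\<bar>t\<bar> \<le> \<theta> * \<tau>" for z t
      using that by (simp add: vertical_shear_def u_def plateau \<rho>_inner algebra_simps)
  qed
qed

lemma ball_vertical_compression:
  fixes C :: "'a::euclidean_space set"
  assumes "is_ball C" "0 < \<delta>" "\<delta> \<le> 1" "0 < s" "s * (1 + 4 / (1 - (1 - \<delta>)\<^sup>2)) < min \<epsilon> 1"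
  shows "\<exists>\<tau>s>0. \<forall>\<tau>. 0 < \<tau> \<and> \<tau> < \<tau>s \<longrightarrow> (\<exists>H. C1_diffeo H \<and>
           (\<forall>x. \<exists>H'. (H has_derivative H') (at x) \<and> onorm (\<lambda>v. H' v - v) \<le> \<epsilon>) \<and>
           (\<forall>p. p \<notin> C \<times> {-\<tau>..\<tau>} \<longrightarrow> H p = p) \<and>
           (\<forall>z t. (z, t) \<in> (\<lambda>p. (1 - \<delta>) *\<^sub>R p) ` (C \<times> {-\<tau>..\<tau>}) \<longrightarrow>
              H (z, t) = (z, (1 - s) * t)))"
proof -
  define K where "K = 1 + 4 / (1 - (1 - \<delta>)\<^sup>2)"
  define e where "e = min \<epsilon> 1"
  obtain \<phi> \<phi>' L where \<phi>: "\<And>z. (\<phi> has_derivative \<phi>' z) (at z)"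
    "\<And>v. continuous_on UNIV (\<lambda>z. \<phi>' z v)" "0 \<le> L" "\<And>z v. \<bar>\<phi>' z v\<bar> \<le> L * norm v"
    "\<And>z. 0 \<le> \<phi> z \<and> \<phi> z \<le> 1" "\<And>z. z \<notin> C \<Longrightarrow> \<phi> z = 0"
    "\<And>z. z \<in> (*\<^sub>R) (1 - \<delta>) ` C \<Longrightarrow> \<phi> z = 1"
    by (rule is_ball_C1_bump_exists[OF assms(1-3)]) blast
  show ?thesis
  proof (rule exI[of _ "(e - s * K) / (s * (L + 1))"], intro conjI allI impI)
    show "0 < (e - s * K) / (s * (L + 1))" using assms \<open>0 \<le> L\<close> by (simp add: K_def e_def)
    fix \<tau> assume \<tau>: "0 < \<tau> \<and> \<tau> < (e - s * K) / (s * (L + 1))"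
    then have "\<tau> * (s * (L + 1)) < e - s * K" using \<open>0 < s\<close> \<open>0 \<le> L\<close> by (simp add: pos_less_divide_eq)
    moreover have "s * (L * \<tau>) \<le> s * ((L + 1) * \<tau>)" using \<open>0 < s\<close> \<tau> by (intro mult_left_mono) auto
    ultimately have small: "s * (L * \<tau> + 1 + 4 / (1 - (1 - \<delta>)\<^sup>2)) < e"
      by (simp add: K_def algebra_simps)
    obtain H where "C1_diffeo H"
      and close: "\<And>x. \<exists>H'. (H has_derivative H') (at x) \<and>
        onorm (\<lambda>v. H' v - v) \<le> s * (L * \<tau> + 1 + 4 / (1 - (1 - \<delta>)\<^sup>2))"
      and "\<And>p. p \<notin> C \<times> {-\<tau>..\<tau>} \<Longrightarrow> H p = p"
      and compressed: "\<And>z t. z \<in> (*\<^sub>R) (1 - \<delta>) ` C \<Longrightarrow> \<bar>t\<bar> \<le> (1 - \<delta>) * \<tau> \<Longrightarrow>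
        H (z, t) = (z, (1 - s) * t)"
      by (rule vertical_compression_exists[OF \<phi>, where \<theta>="1 - \<delta>" and \<tau>=\<tau> and s=s])
        (use assms \<tau> small in \<open>auto simp: e_def\<close>)
    moreover have "\<exists>H'. (H has_derivative H') (at x) \<and> onorm (\<lambda>v. H' v - v) \<le> \<epsilon>" for x
      using close[of x] small by (auto simp: e_def)
    moreover have "H (z, t) = (z, (1 - s) * t)"
      if "(z, t) \<in> (\<lambda>p. (1 - \<delta>) *\<^sub>R p) ` (C \<times> {-\<tau>..\<tau>})" for z t
      using that assms by (auto intro!: compressed simp: abs_mult mult_left_mono)
    ultimately show "\<exists>H. C1_diffeo H \<and>
           (\<forall>x. \<exists>H'. (H has_derivative H') (at x) \<and> onorm (\<lambda>v. H' v - v) \<le> \<epsilon>) \<and>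
           (\<forall>p. p \<notin> C \<times> {-\<tau>..\<tau>} \<longrightarrow> H p = p) \<and>
           (\<forall>z t. (z, t) \<in> (\<lambda>p. (1 - \<delta>) *\<^sub>R p) ` (C \<times> {-\<tau>..\<tau>}) \<longrightarrow>
              H (z, t) = (z, (1 - s) * t))"
      by blast
  qed
qed

theorem lemma4:
  fixes \<epsilon> \<delta> :: real
  assumes "\<epsilon> > 0" and "0 < \<delta>" and "\<delta> < 1"
  shows "\<exists>\<kappa>::real. 0 < \<kappa> \<and> \<kappa> < 1 \<and>
    (\<forall>C :: 'a::euclidean_space set. is_ball C \<longrightarrow>
      (\<exists>\<tau>s::real. \<tau>s > 0 \<and>
        (\<forall>\<tau>. 0 < \<tau> \<and> \<tau> < \<tau>s \<longrightarrow>
          (\<exists>H :: 'a \<times> real \<Rightarrow> 'a \<times> real. C1_diffeo H \<and>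
             (\<forall>x. \<exists>H'. (H has_derivative H') (at x) \<and> onorm (\<lambda>v. H' v - v) \<le> \<epsilon>) \<and>
             (\<forall>p. p \<notin> C \<times> {-\<tau>..\<tau>} \<longrightarrow> H p = p) \<and>
             (\<forall>z t. (z, t) \<in> (\<lambda>p. (1 - \<delta>) *\<^sub>R p) ` (C \<times> {-\<tau>..\<tau>}) \<longrightarrow>
                H (z, t) = (z, \<kappa> * t))))))"
proof -
  define K where "K = 1 + 4 / (1 - (1 - \<delta>)\<^sup>2)"
  define s where "s = min \<epsilon> 1 / (2 * K)"
  have "(1 - \<delta>)\<^sup>2 < 1" using assms by (simp add: power_less_one_iff abs_square_less_1)
  then have "1 \<le> K" by (simp add: K_def)
  then have "0 < s" "s < 1" "s * K < min \<epsilon> 1" using \<open>\<epsilon> > 0\<close> by (auto simp: s_def field_simps)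
  then show ?thesis
    using ball_vertical_compression[OF _ \<open>0 < \<delta>\<close> less_imp_le[OF \<open>\<delta> < 1\<close>], of _ s \<epsilon>]
    by (intro exI[of _ "1 - s"]) (auto simp: K_def)
qed

end
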